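(* Let $a,b,c$ be integers and $r,s,t$ real numbers, let $(V_n)_{n\ge 0}$ be the associated generalized Tribonacci sequence, and let $\varphi_n$ be the $n$th generalized Tribonacci hyperbolic spinor. Assume that the complex roots $\sigma_1,\sigma_2,\sigma_3$ of $x^3-rx^2-sx-t=0$ are pairwise distinct. Then, as power series in $y$, $$e^{-y}\sum_{n=0}^\infty \varphi_n\frac{y^n}{n!}=\frac{\zeta_1\Phi_1e^{\sigma_1y}}{e^y(\sigma_1-\sigma_2)(\sigma_1-\sigma_3)}+\frac{\zeta_2\Phi_2e^{\sigma_2y}}{e^y(\sigma_2-\sigma_1)(\sigma_2-\sigma_3)}+\frac{\zeta_3\Phi_3e^{\sigma_3y}}{e^y(\sigma_3-\sigma_1)(\sigma_3-\sigma_2)},$$ where, for $k=1,2,3$, $\zeta_k=\begin{bmatrix}1+\sigma_k^3 j\\ (-1+\sigma_k j)\sigma_k\end{bmatrix}$, and $\Phi_1=c-(\sigma_2+\sigma_3)b+\sigma_2\sigma_3a$, $\Phi_2=c-(\sigma_1+\sigma_3)b+\sigma_1\sigma_3a$, $\Phi_3=c-(\sigma_1+\sigma_2)b+\sigma_1\sigma_2a$.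
   Context: Hyperbolic numbers are the elements $x+yj$ with $x,y\in\mathbb{R}$ and $j^2=1$ (a commutative ring). A hyperbolic spinor is a column vector with two hyperbolic number components; addition and scalar multiplication are componentwise. Since the $\sigma_k$ may be non-real, the right-hand side is computed with complex coefficients, i.e. in columns over the commutative ring $\mathbb{C}[j]/(j^2-1)$, which contains the hyperbolic numbers. Given integers $a,b,c$ and real numbers $r,s,t$, the generalized Tribonacci sequence $(V_n)_{n\ge0}$ is defined by $V_0=a$, $V_1=b$, $V_2=c$ and $V_n=rV_{n-1}+sV_{n-2}+tV_{n-3}$ for $n\ge 3$. The $n$th generalized Tribonacci hyperbolic spinor is $\varphi_n=\begin{bmatrix} V_n+V_{n+3}j\\ -V_{n+1}+V_{n+2}j\end{bmatrix}$, $n\ge 0$. Power series in $y$ are understood componentwise, with $e^{\sigma y}=\sum_{n\ge0}\sigma^ny^n/n!$. *)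

theory Defs
  imports "HOL-Analysis.Analysis" "HOL-Computational_Algebra.Formal_Power_Series"
begin

text \<open>
  \<open>'a hyp\<close> is the ring \<open>'a[j]/(j\<^sup>2 - 1)\<close>, with \<open>Hyp x y\<close> standing for \<open>x + y j\<close>.
  Hyperbolic numbers are \<open>real hyp\<close>; \<open>complex hyp\<close> is the extension of scalars
  needed for non-real roots.
\<close>

datatype 'a hyp = Hyp (hyp_fst: 'a) (hyp_snd: 'a)

instantiation hyp :: (comm_ring_1) comm_ring_1
begin

definition zero_hyp :: "'a hyp" where "0 = Hyp 0 0"
definition one_hyp :: "'a hyp" where "1 = Hyp 1 0"

definition plus_hyp :: "'a hyp \<Rightarrow> 'a hyp \<Rightarrow> 'a hyp" where
  "z + w = Hyp (hyp_fst z + hyp_fst w) (hyp_snd z + hyp_snd w)"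

definition minus_hyp :: "'a hyp \<Rightarrow> 'a hyp \<Rightarrow> 'a hyp" where
  "z - w = Hyp (hyp_fst z - hyp_fst w) (hyp_snd z - hyp_snd w)"

definition uminus_hyp :: "'a hyp \<Rightarrow> 'a hyp" where
  "- z = Hyp (- hyp_fst z) (- hyp_snd z)"

definition times_hyp :: "'a hyp \<Rightarrow> 'a hyp \<Rightarrow> 'a hyp" where
  "z * w = Hyp (hyp_fst z * hyp_fst w + hyp_snd z * hyp_snd w)
               (hyp_fst z * hyp_snd w + hyp_snd z * hyp_fst w)"

instance
  by standard
    (auto simp: zero_hyp_def one_hyp_def plus_hyp_def minus_hyp_def uminus_hyp_def
      times_hyp_def algebra_simps)

end

definition hyp_j :: "'a::comm_ring_1 hyp" where
  "hyp_j = Hyp 0 1"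

definition hyp_of :: "'a::comm_ring_1 \<Rightarrow> 'a hyp" where
  "hyp_of x = Hyp x 0"

lemma hyp_j_square: "hyp_j * hyp_j = (1 :: 'a::comm_ring_1 hyp)"
  by (simp add: hyp_j_def times_hyp_def one_hyp_def)

lemma Hyp_eq: "Hyp x y = hyp_of x + hyp_of y * hyp_j"
  by (simp add: hyp_j_def hyp_of_def times_hyp_def plus_hyp_def)

type_synonym 'a spinor = "'a hyp ^ 2"

fun gen_trib :: "int \<Rightarrow> int \<Rightarrow> int \<Rightarrow> real \<Rightarrow> real \<Rightarrow> real \<Rightarrow> nat \<Rightarrow> real" where
  "gen_trib a b c r s t 0 = of_int a"
| "gen_trib a b c r s t (Suc 0) = of_int b"
| "gen_trib a b c r s t (Suc (Suc 0)) = of_int c"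
| "gen_trib a b c r s t (Suc (Suc (Suc n))) =
     r * gen_trib a b c r s t (Suc (Suc n)) + s * gen_trib a b c r s t (Suc n)
       + t * gen_trib a b c r s t n"

definition trib_spinor ::
    "int \<Rightarrow> int \<Rightarrow> int \<Rightarrow> real \<Rightarrow> real \<Rightarrow> real \<Rightarrow> nat \<Rightarrow> real spinor" where
  "trib_spinor a b c r s t n =
     (let V = gen_trib a b c r s t in
      vector [hyp_of (V n) + hyp_of (V (n + 3)) * hyp_j,
              - hyp_of (V (n + 1)) + hyp_of (V (n + 2)) * hyp_j])"

definition complexify :: "real spinor \<Rightarrow> complex spinor" where
  "complexify v = (\<chi> i. map_hyp complex_of_real (v $ i))"

text \<open>
  A power series with spinor coefficients is represented componentwise, as a column of
  two power series over \<open>complex hyp\<close>; power series with complex coefficients act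
  on such columns through \<open>fps_hyp_of\<close> and \<open>(*s)\<close>.
\<close>

type_synonym spinor_fps = "(complex hyp) fps ^ 2"

definition fps_hyp_of :: "complex fps \<Rightarrow> complex hyp fps" where
  "fps_hyp_of f = Abs_fps (\<lambda>n. hyp_of (fps_nth f n))"

definition const_spinor_fps :: "complex spinor \<Rightarrow> spinor_fps" where
  "const_spinor_fps v = (\<chi> i. fps_const (v $ i))"

definition spinor_egf :: "(nat \<Rightarrow> complex spinor) \<Rightarrow> spinor_fps" where
  "spinor_egf v = (\<chi> i. Abs_fps (\<lambda>n. hyp_of (1 / fact n) * v n $ i))"

definition zeta_spinor :: "complex \<Rightarrow> complex spinor" where
  "zeta_spinor \<sigma> =
     vector [1 + hyp_of (\<sigma> ^ 3) * hyp_j, (- 1 + hyp_of \<sigma> * hyp_j) * hyp_of \<sigma>]"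

end

theory Submission imports Defs begin

text \<open>
  As \<open>\<sigma>\<^sub>k\<close> is a root of the characteristic polynomial, the geometric sequence
  \<open>\<sigma>\<^sub>k\<^sup>n\<close> satisfies the Tribonacci recurrence. Since the roots are distinct, the combination
  \<open>\<Sum>\<^sub>k A\<^sub>k \<sigma>\<^sub>k\<^sup>n\<close> with \<open>A\<^sub>k\<close> equal to \<open>\<Phi>\<^sub>k\<close> divided by the product of the
  differences of \<open>\<sigma>\<^sub>k\<close> from the other two roots has the initial values
  \<open>a, b, c\<close>; hence it is \<open>V\<^sub>n\<close>. This is the Binet formula \<open>gen_trib_binet\<close>.

  Shifting the index by \<open>i\<close> multiplies the \<open>k\<close>th term by \<open>\<sigma>\<^sub>k\<^sup>i\<close>. The shifts by
  \<open>0, 3\<close> in the first component of the spinor and \<open>1, 2\<close> in the second are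
  exactly the exponents of \<open>\<sigma>\<^sub>k\<close> in \<open>\<zeta>\<^sub>k\<close>, so \<open>\<phi>\<^sub>n = \<Sum>\<^sub>k A\<^sub>k \<sigma>\<^sub>k\<^sup>n \<zeta>\<^sub>k\<close>
  (\<open>trib_spinor_binet\<close>). The exponential generating function is linear and turns the
  geometric spinor sequence \<open>A \<sigma>\<^sup>n \<zeta>\<close> into \<open>A e\<^bsup>\<sigma>y\<^esup> \<zeta>\<close>
  (\<open>spinor_egf_geometric\<close>). Multiplication by \<open>e\<^bsup>-y\<^esup>\<close> then gives the claim.
\<close>

lemma hyp_of_add: "hyp_of (x + y) = hyp_of x + hyp_of y"
  by (simp add: hyp_of_def plus_hyp_def)

lemma hyp_of_mult: "hyp_of (x * y) = hyp_of x * hyp_of y"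
  by (simp add: hyp_of_def times_hyp_def)

lemma hyp_of_sum:
  fixes f :: "'b \<Rightarrow> 'a::comm_ring_1"
  shows "hyp_of (sum f A) = (\<Sum>x\<in>A. hyp_of (f x))"
proof -
  have "hyp_of (0 :: 'a) = 0"
    by (simp add: hyp_of_def zero_hyp_def)
  then show ?thesis
    by (induction A rule: infinite_finite_induct) (simp_all add: hyp_of_add)
qed

lemma fps_hyp_of_mult: "fps_hyp_of (f * g) = fps_hyp_of f * fps_hyp_of g"
  by (rule fps_ext) (simp add: fps_hyp_of_def fps_mult_nth hyp_of_sum hyp_of_mult)

lemma spinor_egf_add: "spinor_egf (\<lambda>n. v n + w n) = spinor_egf v + spinor_egf w"
  by (simp add: spinor_egf_def vec_eq_iff fps_eq_iff algebra_simps)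

lemma spinor_egf_geometric:
  "spinor_egf (\<lambda>n. hyp_of (A * \<sigma> ^ n) *s v)
     = fps_hyp_of (fps_const A * fps_exp \<sigma>) *s const_spinor_fps v"
proof -
  have "hyp_of (1 / fact n) * (hyp_of (A * \<sigma> ^ n) * z) = hyp_of (A * (\<sigma> ^ n / fact n)) * z"
    for n z
    by (simp add: mult.assoc [symmetric] hyp_of_mult [symmetric])
  then show ?thesis
    by (simp add: spinor_egf_def const_spinor_fps_def fps_hyp_of_def vec_eq_iff fps_eq_iff)
qed

text \<open>
  The coefficients come from elimination: with \<open>E\<close> the index shift, the operator
  \<open>(E - \<sigma>\<^sub>2) (E - \<sigma>\<^sub>3)\<close> kills the geometric sequences of \<open>\<sigma>\<^sub>2\<close> and \<open>\<sigma>\<^sub>3\<close>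
  and multiplies that of \<open>\<sigma>\<^sub>1\<close> by \<open>(\<sigma>\<^sub>1 - \<sigma>\<^sub>2) (\<sigma>\<^sub>1 - \<sigma>\<^sub>3)\<close>. Applied to the
  sequence and evaluated at index \<open>0\<close>, it yields
  \<open>c - (\<sigma>\<^sub>2 + \<sigma>\<^sub>3) b + \<sigma>\<^sub>2 \<sigma>\<^sub>3 a\<close>. The proof verifies the three initial values
  and propagates the formula along the common recurrence.
\<close>

lemma gen_trib_binet:
  fixes r s t :: real and \<sigma>1 \<sigma>2 \<sigma>3 :: complex
  assumes root: "\<And>\<sigma>. \<sigma> \<in> {\<sigma>1, \<sigma>2, \<sigma>3} \<Longrightarrow> \<sigma> ^ 3 = of_real r * \<sigma> ^ 2 + of_real s * \<sigma> + of_real t"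
    and distinct: "\<sigma>1 \<noteq> \<sigma>2" "\<sigma>1 \<noteq> \<sigma>3" "\<sigma>2 \<noteq> \<sigma>3"
  shows "of_real (gen_trib a b c r s t n)
     = (of_int c - (\<sigma>2 + \<sigma>3) * of_int b + \<sigma>2 * \<sigma>3 * of_int a)
         / ((\<sigma>1 - \<sigma>2) * (\<sigma>1 - \<sigma>3)) * \<sigma>1 ^ n
     + (of_int c - (\<sigma>1 + \<sigma>3) * of_int b + \<sigma>1 * \<sigma>3 * of_int a)
         / ((\<sigma>2 - \<sigma>1) * (\<sigma>2 - \<sigma>3)) * \<sigma>2 ^ n
     + (of_int c - (\<sigma>1 + \<sigma>2) * of_int b + \<sigma>1 * \<sigma>2 * of_int a)
         / ((\<sigma>3 - \<sigma>1) * (\<sigma>3 - \<sigma>2)) * \<sigma>3 ^ n"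
  (is "_ = ?A1 * _ + ?A2 * _ + ?A3 * _")
proof -
  have init: "?A1 + ?A2 + ?A3 = of_int a"
    "?A1 * \<sigma>1 + ?A2 * \<sigma>2 + ?A3 * \<sigma>3 = of_int b"
    "?A1 * \<sigma>1 ^ 2 + ?A2 * \<sigma>2 ^ 2 + ?A3 * \<sigma>3 ^ 2 = of_int c"
    using distinct by (simp_all add: divide_simps) (simp_all add: algebra_simps power2_eq_square)
  define A1 A2 A3 where A: "A1 = ?A1" "A2 = ?A2" "A3 = ?A3"
  note init = init [folded A]
  have step: "\<sigma> ^ Suc (Suc (Suc n)) = r * \<sigma> ^ Suc (Suc n) + s * \<sigma> ^ Suc n + t * \<sigma> ^ n"
    if "\<sigma> \<in> {\<sigma>1, \<sigma>2, \<sigma>3}" for \<sigma> :: complex and n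
  proof -
    have "\<sigma> ^ Suc (Suc (Suc n)) = \<sigma> ^ 3 * \<sigma> ^ n"
      by (simp add: power3_eq_cube)
    also have "\<dots> = (r * \<sigma> ^ 2 + s * \<sigma> + t) * \<sigma> ^ n"
      by (simp only: root [OF that])
    finally show ?thesis
      by (simp add: power2_eq_square algebra_simps)
  qed
  have "of_real (gen_trib a b c r s t n) = A1 * \<sigma>1 ^ n + A2 * \<sigma>2 ^ n + A3 * \<sigma>3 ^ n"
  proof (induction n rule: less_induct)
    case (less n)
    consider "n = 0" | "n = 1" | "n = 2" | m where "n = Suc (Suc (Suc m))"
      by (metis One_nat_def Suc_1 not0_implies_Suc)
    then show ?case
    proof cases
      case 4
      note IH = less [of m] less [of "Suc m"] less [of "Suc (Suc m)"]
      have "of_real (gen_trib a b c r s t n)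
          = r * of_real (gen_trib a b c r s t (Suc (Suc m)))
            + s * of_real (gen_trib a b c r s t (Suc m))
            + t * complex_of_real (gen_trib a b c r s t m)"
        by (simp add: 4)
      also have "\<dots> = A1 * \<sigma>1 ^ Suc (Suc (Suc m)) + A2 * \<sigma>2 ^ Suc (Suc (Suc m))
            + A3 * \<sigma>3 ^ Suc (Suc (Suc m))"
        using step [of \<sigma>1] step [of \<sigma>2] step [of \<sigma>3]
        by (simp add: IH 4 algebra_simps del: power_Suc)
      finally show ?thesis
        by (simp only: 4)
    qed (use init in \<open>simp_all add: numeral_2_eq_2\<close>)
  qed
  then show ?thesis
    by (simp only: A)
qed

text \<open>
  In the term of a root \<open>\<sigma>\<close>, the value at index \<open>n + i\<close> is \<open>\<sigma>\<^sup>i\<close> times the value at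
  index \<open>n\<close>; these factors, for the four indices in the spinor, make up
  \<open>zeta_spinor \<sigma>\<close>.
\<close>

lemma trib_spinor_binet:
  assumes binet: "\<And>n. of_real (gen_trib a b c r s t n)
    = A1 * \<sigma>1 ^ n + A2 * \<sigma>2 ^ n + A3 * \<sigma>3 ^ n"
  shows "complexify (trib_spinor a b c r s t n)
     = hyp_of (A1 * \<sigma>1 ^ n) *s zeta_spinor \<sigma>1 + hyp_of (A2 * \<sigma>2 ^ n) *s zeta_spinor \<sigma>2
     + hyp_of (A3 * \<sigma>3 ^ n) *s zeta_spinor \<sigma>3"
proof -
  have V: "complexify (trib_spinor a b c r s t n)
      = vector [Hyp (of_real (gen_trib a b c r s t n)) (of_real (gen_trib a b c r s t (n + 3))),
          Hyp (- of_real (gen_trib a b c r s t (n + 1))) (of_real (gen_trib a b c r s t (n + 2)))]"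
    by (simp add: complexify_def trib_spinor_def Let_def vec_eq_iff forall_2 vector_2
        hyp_of_def hyp_j_def plus_hyp_def times_hyp_def uminus_hyp_def del: gen_trib.simps)
  show ?thesis
    unfolding V binet
    by (simp add: zeta_spinor_def vec_eq_iff forall_2 vector_2 hyp_of_def hyp_j_def plus_hyp_def
        times_hyp_def one_hyp_def uminus_hyp_def power_add algebra_simps eval_nat_numeral)
qed

lemma fps_exp_quotient:
  fixes \<Phi> \<sigma> D :: "'a::field_char_0"
  assumes "D \<noteq> 0"
  shows "fps_const \<Phi> * fps_exp \<sigma> / (fps_exp 1 * fps_const D)
     = fps_exp (- 1) * (fps_const (\<Phi> / D) * fps_exp \<sigma>)"
proof -
  have "fps_nth (fps_exp 1 * fps_const D) 0 \<noteq> 0"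
    using assms by simp
  then have "fps_const \<Phi> * fps_exp \<sigma> / (fps_exp 1 * fps_const D)
      = fps_const \<Phi> * fps_exp \<sigma> * (fps_exp (- 1) * fps_const (1 / D))"
    using assms
    by (simp add: fps_divide_unit fps_inverse_mult fps_const_inverse fps_exp_neg divide_inverse)
  also have "\<dots> = fps_exp (- 1) * ((fps_const \<Phi> * fps_const (1 / D)) * fps_exp \<sigma>)"
    by (simp only: mult_ac)
  finally show ?thesis
    by (simp add: fps_const_mult)
qed

theorem theorem3p11:
  fixes a b c :: int and r s t :: real and \<sigma>1 \<sigma>2 \<sigma>3 :: complex
  assumes roots: "{x :: complex. x ^ 3 - of_real r * x ^ 2 - of_real s * x - of_real t = 0}
                    = {\<sigma>1, \<sigma>2, \<sigma>3}"
    and distinct: "\<sigma>1 \<noteq> \<sigma>2" "\<sigma>1 \<noteq> \<sigma>3" "\<sigma>2 \<noteq> \<sigma>3"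
  shows
    "let \<Phi>1 = of_int c - (\<sigma>2 + \<sigma>3) * of_int b + \<sigma>2 * \<sigma>3 * of_int a;
         \<Phi>2 = of_int c - (\<sigma>1 + \<sigma>3) * of_int b + \<sigma>1 * \<sigma>3 * of_int a;
         \<Phi>3 = of_int c - (\<sigma>1 + \<sigma>2) * of_int b + \<sigma>1 * \<sigma>2 * of_int a
     in fps_hyp_of (fps_exp (- 1)) *s spinor_egf (\<lambda>n. complexify (trib_spinor a b c r s t n))
        = fps_hyp_of (fps_const \<Phi>1 * fps_exp \<sigma>1
              / (fps_exp 1 * fps_const ((\<sigma>1 - \<sigma>2) * (\<sigma>1 - \<sigma>3))))
            *s const_spinor_fps (zeta_spinor \<sigma>1)
        + fps_hyp_of (fps_const \<Phi>2 * fps_exp \<sigma>2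
              / (fps_exp 1 * fps_const ((\<sigma>2 - \<sigma>1) * (\<sigma>2 - \<sigma>3))))
            *s const_spinor_fps (zeta_spinor \<sigma>2)
        + fps_hyp_of (fps_const \<Phi>3 * fps_exp \<sigma>3
              / (fps_exp 1 * fps_const ((\<sigma>3 - \<sigma>1) * (\<sigma>3 - \<sigma>2))))
            *s const_spinor_fps (zeta_spinor \<sigma>3)"
proof -
  define A1 where
    "A1 = (of_int c - (\<sigma>2 + \<sigma>3) * of_int b + \<sigma>2 * \<sigma>3 * of_int a) / ((\<sigma>1 - \<sigma>2) * (\<sigma>1 - \<sigma>3))"
  define A2 where
    "A2 = (of_int c - (\<sigma>1 + \<sigma>3) * of_int b + \<sigma>1 * \<sigma>3 * of_int a) / ((\<sigma>2 - \<sigma>1) * (\<sigma>2 - \<sigma>3))"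
  define A3 where
    "A3 = (of_int c - (\<sigma>1 + \<sigma>2) * of_int b + \<sigma>1 * \<sigma>2 * of_int a) / ((\<sigma>3 - \<sigma>1) * (\<sigma>3 - \<sigma>2))"
  note A = A1_def A2_def A3_def
  have root: "\<sigma> ^ 3 = of_real r * \<sigma> ^ 2 + of_real s * \<sigma> + of_real t"
    if "\<sigma> \<in> {\<sigma>1, \<sigma>2, \<sigma>3}" for \<sigma>
    using that unfolding roots [symmetric] by (simp add: algebra_simps)
  have binet: "of_real (gen_trib a b c r s t n) = A1 * \<sigma>1 ^ n + A2 * \<sigma>2 ^ n + A3 * \<sigma>3 ^ n" for n
    unfolding A by (rule gen_trib_binet [OF root distinct])
  have "spinor_egf (\<lambda>n. complexify (trib_spinor a b c r s t n))
      = fps_hyp_of (fps_const A1 * fps_exp \<sigma>1) *s const_spinor_fps (zeta_spinor \<sigma>1)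
      + fps_hyp_of (fps_const A2 * fps_exp \<sigma>2) *s const_spinor_fps (zeta_spinor \<sigma>2)
      + fps_hyp_of (fps_const A3 * fps_exp \<sigma>3) *s const_spinor_fps (zeta_spinor \<sigma>3)"
    by (simp only: trib_spinor_binet [OF binet] spinor_egf_add spinor_egf_geometric)
  moreover have "(\<sigma>1 - \<sigma>2) * (\<sigma>1 - \<sigma>3) \<noteq> 0" "(\<sigma>2 - \<sigma>1) * (\<sigma>2 - \<sigma>3) \<noteq> 0"
    "(\<sigma>3 - \<sigma>1) * (\<sigma>3 - \<sigma>2) \<noteq> 0"
    using distinct by simp_all
  ultimately show ?thesis
    by (simp only: Let_def fps_exp_quotient A [symmetric] fps_hyp_of_mult [of "fps_exp (- 1)"]
        vector_smult_assoc [symmetric] vector_add_ldistrib not_False_eq_True)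
qed

end
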